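(* Let $k, r, d_1,\dots,d_k$ be positive integers, let $\Omega$ be a closed convex subset of $\mathbb{R}_+^{d_1\times\dots\times d_k}$, and let $A\in\Omega$. Let $D_\varphi:\Omega\times\operatorname{ri}(\Omega)\to\mathbb{R}$ be a Brègman divergence. Then $$\inf\{D_\varphi(A,X)\mid X\in K,\ \operatorname{rank}_+(X)\le r\}$$ is attained for any closed subset $K\subseteq\operatorname{ri}(\Omega)$ (closed meaning closed in $\mathbb{R}^{d_1\times\dots\times d_k}$).
   Context: A tensor is a hypermatrix $(a_{j_1\cdots j_k})\in\mathbb{R}^{d_1\times\dots\times d_k}$; $\mathbb{R}_+^{d_1\times\dots\times d_k}$ is the set of tensors with all entries $\ge 0$. The inner product is $\langle A,B\rangle=\sum_{j_1,\dots,j_k}a_{j_1\cdots j_k}b_{j_1\cdots j_k}$, and $\lVert\cdot\rVert$ is any fixed norm on $\mathbb{R}^{d_1\times\dots\times d_k}$ (the choice is immaterial). Nonnegative rank: for $X\in\mathbb{R}_+^{d_1\times\dots\times d_k}$, $\operatorname{rank}_+(X)$ is the minimal $r$ such that $X=\sum_{p=1}^r\delta_p\,\mathbf{u}_p\otimes\mathbf{v}_p\otimes\dots\otimes\mathbf{z}_p$ with all $\delta_p\ge 0$ and all ($k$ per term) vectors $\mathbf{u}_p\in\mathbb{R}^{d_1},\mathbf{v}_p\in\mathbb{R}^{d_2},\dots,\mathbf{z}_p\in\mathbb{R}^{d_k}$ entrywise nonnegative; here $\mathbf{u}\otimes\mathbf{v}\otimes\dots\otimes\mathbf{z}$ is the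 tensor with $(j_1,\dots,j_k)$ entry $u_{j_1}v_{j_2}\cdots z_{j_k}$. $\operatorname{ri}(\Omega)$ is the relative interior of $\Omega$, i.e. its interior as a subset of its affine hull. Brègman divergence: let $\varnothing\ne\Omega\subseteq\mathbb{R}^{d_1\times\dots\times d_k}$ be a closed convex set, and let $\varphi:\Omega\to\mathbb{R}$ be continuously differentiable on $\operatorname{ri}(\Omega)$ and strictly convex and continuous on $\Omega$. (If $\Omega$ is not full-dimensional, differentiability is understood within the affine hull of $\Omega$, and $\langle\nabla\varphi(B),A-B\rangle$ is the derivative of $\varphi$ at $B$ in the direction $A-B$.) The function $D_\varphi:\Omega\times\operatorname{ri}(\Omega)\to\mathbb{R}$, $$D_\varphi(A,B)=\varphi(A)-\varphi(B)-\langle\nabla\varphi(B),A-B\rangle,$$ is called a Brègman divergence if: (i) for any fixed $A\in\Omega$, the sublevel set $\mathcal{L}_\alpha(A)=\{X\in\operatorname{ri}(\Omega)\mid D_\varphi(A,X)\le\alpha\}$ is bounded for all $\alpha\in\mathbb{R}$; (ii) whenever $(X_n)_{n=1}^\infty\subset\operatorname{ri}(\Omega)$ and $A\in\Omega$ satisfy $\lim_{n\to\infty}\lVert A-X_n\rVert=0$, then $\lim_{n\to\infty}D_\varphi(A,X_n)=0$; (iii) whenever $(X_n)_{n=1}^\infty\subset\operatorname{ri}(\Omega)$, $A\in\Omega$ and $(A_n)_{n=1}^\infty\subset\Omega$ satisfy $\lim_{n\to\infty}\lVert A-X_n\rVert=0$, $\limsup_{n\to\infty}\lVert A_n\rVert<\infty$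 and $\lim_{n\to\infty}D_\varphi(A_n,X_n)=0$, then $\lim_{n\to\infty}\lVert A_n-X_n\rVert=0$. *)

theory Defs
  imports "HOL-Analysis.Analysis" "HOL-Analysis.Finite_Function_Topology"
begin

text \<open>
  The order \<open>k\<close> and the dimensions \<open>d 0, \<dots>, d (k - 1)\<close> are ordinary natural numbers (indices start
  at 0). The space of \<open>d 0 \<times> \<dots> \<times> d (k - 1)\<close> tensors is the subspace \<open>tensors k d\<close> of the
  normed space of finitely supported functions on lists of natural numbers; the multi-index
  \<open>(j\<^sub>1, \<dots>, j\<^sub>k)\<close> is a list of length \<open>k\<close>. The norm of the ambient type is the sum of the absolute
  values of the entries, and \<open>tensors k d\<close> is a closed finite-dimensional subspace, so closedness,
  boundedness, limits, affine hulls and relative interiors of subsets of \<open>tensors k d\<close> are the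
  usual ones.
\<close>

type_synonym tensor = "nat list \<Rightarrow>\<^sub>0 real"

definition multi_indices :: "nat \<Rightarrow> (nat \<Rightarrow> nat) \<Rightarrow> nat list set" where
  "multi_indices k d = {js. length js = k \<and> (\<forall>i<k. js ! i < d i)}"

definition tensors :: "nat \<Rightarrow> (nat \<Rightarrow> nat) \<Rightarrow> tensor set" where
  "tensors k d = {X. Poly_Mapping.keys X \<subseteq> multi_indices k d}"

definition nonneg_tensors :: "nat \<Rightarrow> (nat \<Rightarrow> nat) \<Rightarrow> tensor set" where
  "nonneg_tensors k d = {X \<in> tensors k d. \<forall>js\<in>multi_indices k d. 0 \<le> Poly_Mapping.lookup X js}"

text \<open>
  The outer product of the vectors \<open>u 0, \<dots>, u (k - 1)\<close>. A vector in \<open>\<real>\<^sup>n\<close> with \<open>n = d i\<close> is a function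
  \<open>u i\<close> on the natural numbers of which only the values below \<open>d i\<close> are used.
\<close>

definition outer_product :: "nat \<Rightarrow> (nat \<Rightarrow> nat) \<Rightarrow> (nat \<Rightarrow> nat \<Rightarrow> real) \<Rightarrow> tensor" where
  "outer_product k d u =
     (\<Sum>js\<in>multi_indices k d. Poly_Mapping.single js (\<Prod>i<k. u i (js ! i)))"

definition has_nonneg_decomposition :: "nat \<Rightarrow> (nat \<Rightarrow> nat) \<Rightarrow> tensor \<Rightarrow> nat \<Rightarrow> bool" where
  "has_nonneg_decomposition k d X r \<longleftrightarrow>
     (\<exists>(\<delta> :: nat \<Rightarrow> real) (u :: nat \<Rightarrow> nat \<Rightarrow> nat \<Rightarrow> real).
        (\<forall>p<r. 0 \<le> \<delta> p) \<and>
        (\<forall>p<r. \<forall>i<k. \<forall>j<d i. 0 \<le> u p i j) \<and>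
        X = (\<Sum>p<r. \<delta> p *\<^sub>R outer_product k d (u p)))"

definition nonneg_rank :: "nat \<Rightarrow> (nat \<Rightarrow> nat) \<Rightarrow> tensor \<Rightarrow> nat" where
  "nonneg_rank k d X = (LEAST r. has_nonneg_decomposition k d X r)"

definition strictly_convex_on :: "'a::real_vector set \<Rightarrow> ('a \<Rightarrow> real) \<Rightarrow> bool" where
  "strictly_convex_on S f \<longleftrightarrow> convex S \<and>
     (\<forall>x\<in>S. \<forall>y\<in>S. \<forall>t. x \<noteq> y \<longrightarrow> 0 < t \<longrightarrow> t < 1 \<longrightarrow>
        f ((1 - t) *\<^sub>R x + t *\<^sub>R y) < (1 - t) * f x + t * f y)"

text \<open>
  Differentiability at a point of the relative interior is understood within the affine hull.
  Values of \<open>\<phi>\<close> outside \<open>\<Omega>\<close> play no role, because the relative interior is open in the affine hull.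
\<close>

definition C1_on_rel_interior :: "tensor set \<Rightarrow> (tensor \<Rightarrow> real) \<Rightarrow> bool" where
  "C1_on_rel_interior \<Omega> \<phi> \<longleftrightarrow>
     (\<exists>\<phi>' :: tensor \<Rightarrow> tensor \<Rightarrow>\<^sub>L real.
        (\<forall>B\<in>rel_interior \<Omega>.
           (\<phi> has_derivative blinfun_apply (\<phi>' B)) (at B within affine hull \<Omega>)) \<and>
        continuous_on (rel_interior \<Omega>) \<phi>')"

text \<open>
  The derivative within the affine hull is determined only on differences of points of the affine
  hull. The increment \<open>A - B\<close> is one, so the term \<open>\<langle>\<nabla>\<phi>(B), A - B\<rangle>\<close> does not depend on which
  derivative \<open>frechet_derivative\<close> selects.
\<close>

definition D_breg :: "tensor set \<Rightarrow> (tensor \<Rightarrow> real) \<Rightarrow> tensor \<Rightarrow> tensor \<Rightarrow> real" where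
  "D_breg \<Omega> \<phi> A B =
     \<phi> A - \<phi> B - frechet_derivative \<phi> (at B within affine hull \<Omega>) (A - B)"

definition bregman_divergence :: "tensor set \<Rightarrow> (tensor \<Rightarrow> real) \<Rightarrow> bool" where
  "bregman_divergence \<Omega> \<phi> \<longleftrightarrow>
     \<Omega> \<noteq> {} \<and> closed \<Omega> \<and> convex \<Omega> \<and>
     C1_on_rel_interior \<Omega> \<phi> \<and> strictly_convex_on \<Omega> \<phi> \<and> continuous_on \<Omega> \<phi> \<and>
     (\<forall>A\<in>\<Omega>. \<forall>\<alpha>. bounded {X \<in> rel_interior \<Omega>. D_breg \<Omega> \<phi> A X \<le> \<alpha>}) \<and>
     (\<forall>X A. (\<forall>n. X n \<in> rel_interior \<Omega>) \<longrightarrow> A \<in> \<Omega> \<longrightarrow>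
        (\<lambda>n. norm (A - X n)) \<longlonglongrightarrow> 0 \<longrightarrow>
        (\<lambda>n. D_breg \<Omega> \<phi> A (X n)) \<longlonglongrightarrow> 0) \<and>
     (\<forall>X A A'. (\<forall>n. X n \<in> rel_interior \<Omega>) \<longrightarrow> A \<in> \<Omega> \<longrightarrow> (\<forall>n. A' n \<in> \<Omega>) \<longrightarrow>
        (\<lambda>n. norm (A - X n)) \<longlonglongrightarrow> 0 \<longrightarrow>
        limsup (\<lambda>n. ereal (norm (A' n))) < \<infinity> \<longrightarrow>
        (\<lambda>n. D_breg \<Omega> \<phi> (A' n) (X n)) \<longlonglongrightarrow> 0 \<longrightarrow>
        (\<lambda>n. norm (A' n - X n)) \<longlonglongrightarrow> 0)"

lemma finite_multi_indices: "finite (multi_indices k d)"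
proof (rule finite_subset)
  show "multi_indices k d \<subseteq> {js. set js \<subseteq> (\<Union>i<k. {..<d i}) \<and> length js = k}"
    unfolding multi_indices_def in_set_conv_nth subset_iff by blast
  show "finite {js. set js \<subseteq> (\<Union>i<k. {..<d i}) \<and> length js = k}"
    by (rule finite_lists_length_eq) auto
qed

lemma lookup_outer_product:
  "Poly_Mapping.lookup (outer_product k d u) js =
     (if js \<in> multi_indices k d then \<Prod>i<k. u i (js ! i) else 0)"
  by (simp add: outer_product_def lookup_sum lookup_single when_def finite_multi_indices
      sum.delta')

lemma lookup_scaleR_tensor:
  "Poly_Mapping.lookup (c *\<^sub>R X) js = c * Poly_Mapping.lookup (X :: tensor) js"
  by (simp add: scaleR_poly_mapping_def)

text \<open>Every nonnegative tensor has a decomposition, so the minimum in \<open>nonneg_rank\<close> exists.\<close>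

lemma has_nonneg_decomposition_exists:
  assumes "X \<in> nonneg_tensors k d"
  shows "\<exists>r. has_nonneg_decomposition k d X r"
proof -
  define I where "I = multi_indices k d"
  obtain e where e: "bij_betw e {..<card I} I"
    using ex_bij_betw_nat_finite[OF finite_multi_indices[of k d]]
    by (auto simp: I_def atLeast0LessThan)
  define u :: "nat \<Rightarrow> nat \<Rightarrow> nat \<Rightarrow> real" where "u p i j = (if j = e p ! i then 1 else 0)" for p i j
  have eI: "e p \<in> I" if "p < card I" for p
    using e that by (auto simp: bij_betw_def)
  have outer: "outer_product k d (u p) = Poly_Mapping.single (e p) 1" if p: "p < card I" for p
  proof (rule poly_mapping_eqI)
    fix js
    have "(\<Prod>i<k. u p i (js ! i)) = (if js = e p then 1 else 0)" if "js \<in> I"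
    proof (cases "js = e p")
      case False
      have len: "length js = k" "length (e p) = k"
        using that eI[OF p] by (simp_all add: I_def multi_indices_def)
      have "\<not> (\<forall>i<k. js ! i = e p ! i)"
        using False len by (simp add: list_eq_iff_nth_eq)
      then obtain i where "i < k" "js ! i \<noteq> e p ! i"
        by blast
      then have "(\<Prod>i<k. u p i (js ! i)) = 0"
        by (intro prod_zero) (auto simp: u_def)
      then show ?thesis using False by simp
    qed (simp add: u_def)
    then show "Poly_Mapping.lookup (outer_product k d (u p)) js =
        Poly_Mapping.lookup (Poly_Mapping.single (e p) 1) js"
      using eI[OF p] by (auto simp: lookup_outer_product lookup_single when_def I_def)
  qed
  have "X = (\<Sum>js\<in>I. Poly_Mapping.lookup X js *\<^sub>R Poly_Mapping.single js 1)"
  proof (rule poly_mapping_eqI)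
    fix js
    show "Poly_Mapping.lookup X js =
        Poly_Mapping.lookup (\<Sum>js\<in>I. Poly_Mapping.lookup X js *\<^sub>R Poly_Mapping.single js 1) js"
      using assms finite_multi_indices[of k d]
      by (auto simp: nonneg_tensors_def tensors_def I_def lookup_sum lookup_single when_def
          lookup_scaleR_tensor if_distrib sum.delta in_keys_iff cong: if_cong)
  qed
  also have "\<dots> = (\<Sum>p<card I. Poly_Mapping.lookup X (e p) *\<^sub>R Poly_Mapping.single (e p) 1)"
    by (rule sum.reindex_bij_betw[OF e, symmetric])
  also have "\<dots> = (\<Sum>p<card I. Poly_Mapping.lookup X (e p) *\<^sub>R outer_product k d (u p))"
    by (simp add: outer)
  finally have X: "X = (\<Sum>p<card I. Poly_Mapping.lookup X (e p) *\<^sub>R outer_product k d (u p))" .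
  have "0 \<le> Poly_Mapping.lookup X (e p)" if "p < card I" for p
    using assms eI[OF that] by (auto simp: nonneg_tensors_def I_def)
  moreover have "\<forall>p<card I. \<forall>i<k. \<forall>j<d i. 0 \<le> u p i j"
    by (simp add: u_def)
  ultimately show ?thesis
    unfolding has_nonneg_decomposition_def using X
    by (intro exI[of _ "card I"] exI[of _ "\<lambda>p. Poly_Mapping.lookup X (e p)"] exI[of _ u]) simp
qed

end

theory Submission
  imports Defs
begin

text \<open>
  The search for a minimizer may be restricted to a sublevel set of \<open>D_breg \<Omega> \<phi> A\<close>, which is bounded
  by the first condition on a Bregman divergence. On the relative interior, hence on the closed set
  \<open>K\<close>, the divergence is continuous in its second argument (\<open>continuous_on_D_breg\<close>). So the infimum is
  attained as soon as the nonnegative tensors of nonnegative rank at most \<open>r\<close> and norm at most \<open>M\<close> lie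
  in a compact set of tensors of nonnegative rank at most \<open>r\<close>.

  Nonnegativity provides this compact set. In a sum of nonnegative rank-one tensors nothing cancels,
  so every entry of a summand is at most the corresponding entry of the sum. Dividing each vector by
  its largest entry makes that largest entry 1, and then the coefficient \<open>\<delta> p\<close> is itself an entry of
  the \<open>p\<close>-th summand. Hence all coefficients lie in \<open>[0, M]\<close> and all vectors in \<open>[0, 1]\<close>
  (\<open>bounded_decomposition_if_nonneg_rank_le\<close>), and the tensors with such a decomposition form the
  continuous image of a product of compact intervals (\<open>compact_bounded_decompositions\<close>). For
  arbitrary real decompositions the summands can diverge while their sum converges.
\<close>

section \<open>Continuity of the divergence in its second argument\<close>

text \<open>
  Any two derivatives within the affine hull agree along \<open>A - B\<close>, because the whole line through \<open>A\<close>
  and \<open>B\<close> lies in the affine hull and the derivative along a line is unique.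
\<close>

lemma has_derivative_within_affine_hull_unique:
  fixes f :: "'a::real_normed_vector \<Rightarrow> real"
  assumes f: "(f has_derivative F) (at B within affine hull S)"
    and g: "(f has_derivative G) (at B within affine hull S)"
    and A: "A \<in> affine hull S" and B: "B \<in> affine hull S"
  shows "F (A - B) = G (A - B)"
proof -
  define l where "l t = B + t *\<^sub>R (A - B)" for t :: real
  have l: "range l \<subseteq> affine hull S"
  proof clarify
    fix t
    have "l t = (1 - t) *\<^sub>R B + t *\<^sub>R A"
      by (simp add: l_def algebra_simps)
    then show "l t \<in> affine hull S"
      using mem_affine[OF affine_affine_hull B A, of "1 - t" t] by simp
  qed
  have l': "(l has_derivative (\<lambda>t. t *\<^sub>R (A - B))) (at 0)"
    unfolding l_def by (auto intro!: derivative_eq_intros)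
  have line: "((\<lambda>t. f (l t)) has_derivative (\<lambda>t. H (t *\<^sub>R (A - B)))) (at 0)"
    if "(f has_derivative H) (at B within affine hull S)" for H
  proof (rule has_derivative_in_compose[OF l'])
    show "(f has_derivative H) (at (l 0) within range l)"
      using has_derivative_subset[OF that l] by (simp add: l_def)
  qed
  have "(\<lambda>t. F (t *\<^sub>R (A - B))) = (\<lambda>t. G (t *\<^sub>R (A - B)))"
    using has_derivative_unique[OF line[OF f] line[OF g]] .
  from fun_cong[OF this, of 1] show ?thesis
    by simp
qed

lemma continuous_on_D_breg:
  assumes "C1_on_rel_interior \<Omega> \<phi>" and "continuous_on \<Omega> \<phi>" and A: "A \<in> \<Omega>"
  shows "continuous_on (rel_interior \<Omega>) (D_breg \<Omega> \<phi> A)"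
proof -
  obtain \<phi>' :: "tensor \<Rightarrow> tensor \<Rightarrow>\<^sub>L real" where
    deriv: "\<And>B. B \<in> rel_interior \<Omega> \<Longrightarrow>
      (\<phi> has_derivative blinfun_apply (\<phi>' B)) (at B within affine hull \<Omega>)"
    and cont: "continuous_on (rel_interior \<Omega>) \<phi>'"
    using assms(1) unfolding C1_on_rel_interior_def by blast
  have "D_breg \<Omega> \<phi> A B = \<phi> A - \<phi> B - blinfun_apply (\<phi>' B) (A - B)"
    if B: "B \<in> rel_interior \<Omega>" for B
  proof -
    have "(\<phi> has_derivative frechet_derivative \<phi> (at B within affine hull \<Omega>))
        (at B within affine hull \<Omega>)"
      by (rule frechet_derivative_works[THEN iffD1, OF differentiableI[OF deriv[OF B]]])
    moreover have "A \<in> affine hull \<Omega>" "B \<in> affine hull \<Omega>"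
      using A B rel_interior_subset[of \<Omega>] hull_subset[of \<Omega> affine] by blast+
    ultimately show ?thesis
      using has_derivative_within_affine_hull_unique[OF _ deriv[OF B]] by (simp add: D_breg_def)
  qed
  moreover have "continuous_on (rel_interior \<Omega>)
      (\<lambda>B. \<phi> A - \<phi> B - blinfun_apply (\<phi>' B) (A - B))"
    by (intro continuous_intros cont continuous_on_subset[OF assms(2)] rel_interior_subset)
  ultimately show ?thesis
    by (simp cong: continuous_on_cong)
qed

section \<open>Compactness of bounded sets of bounded nonnegative rank\<close>

lemma abs_lookup_le_norm:
  fixes X :: tensor
  shows "\<bar>Poly_Mapping.lookup X js\<bar> \<le> norm X"
proof (cases "js \<in> Poly_Mapping.keys X")
  case True
  then show ?thesis
    unfolding norm_poly_mapping_def dist_poly_mapping_def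
    by (auto simp: in_keys_iff intro!: member_le_sum[where f="\<lambda>n. \<bar>Poly_Mapping.lookup X n\<bar>"])
next
  case False
  then show ?thesis
    by (simp add: in_keys_iff)
qed

text \<open>
  Dividing each \<open>u i\<close> by its maximal entry \<open>u i (m i)\<close> moves the scale into the coefficient, which
  becomes the entry of the rank-one tensor at the multi-index \<open>m\<close>. A zero vector needs no separate
  treatment: with \<open>x / 0 = 0\<close> both coefficient and vector become zero, as does the tensor.
\<close>

lemma normalized_outer_product:
  fixes \<delta> M :: real and u :: "nat \<Rightarrow> nat \<Rightarrow> real"
  assumes "0 \<le> \<delta>" and u: "\<And>i j. i < k \<Longrightarrow> j < d i \<Longrightarrow> 0 \<le> u i j"
    and d: "\<And>i. i < k \<Longrightarrow> 0 < d i"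
    and M: "\<And>js. Poly_Mapping.lookup (\<delta> *\<^sub>R outer_product k d u) js \<le> M"
  obtains \<delta>' u' where "\<delta>' \<in> {0..M}" and "\<And>i j. u' i j \<in> {0..1::real}"
    and "\<delta>' *\<^sub>R outer_product k d u' = \<delta> *\<^sub>R outer_product k d u"
proof -
  have "\<exists>j<d i. \<forall>j'<d i. u i j' \<le> u i j" if "i < k" for i
  proof -
    have "Max (u i ` {..<d i}) \<in> u i ` {..<d i}"
      using d[OF that] by (intro Max_in) auto
    then obtain j where "j < d i" "u i j = Max (u i ` {..<d i})"
      by auto
    then show ?thesis
      by (metis Max_ge finite_imageI finite_lessThan imageI lessThan_iff)
  qed
  then obtain m where m: "\<And>i. i < k \<Longrightarrow> m i < d i"
    and max: "\<And>i j. i < k \<Longrightarrow> j < d i \<Longrightarrow> u i j \<le> u i (m i)"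
    by metis
  define \<delta>' where "\<delta>' = \<delta> * (\<Prod>i<k. u i (m i))"
  define u' where "u' i j = (if i < k \<and> j < d i then u i j / u i (m i) else 0)" for i j
  have "\<delta>' = Poly_Mapping.lookup (\<delta> *\<^sub>R outer_product k d u) (map m [0..<k])"
    using m by (simp add: \<delta>'_def lookup_scaleR_tensor lookup_outer_product multi_indices_def)
  then have "\<delta>' \<le> M"
    using M by simp
  moreover have "0 \<le> \<delta>'"
    using \<open>0 \<le> \<delta>\<close> u m by (auto simp: \<delta>'_def intro!: mult_nonneg_nonneg prod_nonneg)
  moreover have "u' i j \<in> {0..1}" for i j
    using u[of i j] u[of i "m i"] m[of i] max[of i j]
    by (auto simp: u'_def divide_le_eq_1)
  moreover have "\<delta>' *\<^sub>R outer_product k d u' = \<delta> *\<^sub>R outer_product k d u"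
  proof (rule poly_mapping_eqI)
    fix js
    have "(\<Prod>i<k. u i (m i)) * (\<Prod>i<k. u' i (js ! i)) = (\<Prod>i<k. u i (js ! i))"
      if "js \<in> multi_indices k d"
      unfolding prod.distrib[symmetric]
    proof (rule prod.cong)
      fix i assume "i \<in> {..<k}"
      then have "i < k" "js ! i < d i"
        using that by (auto simp: multi_indices_def)
      then show "u i (m i) * u' i (js ! i) = u i (js ! i)"
        using u[of i "js ! i"] max[of i "js ! i"] by (auto simp: u'_def)
    qed simp
    then show "Poly_Mapping.lookup (\<delta>' *\<^sub>R outer_product k d u') js =
        Poly_Mapping.lookup (\<delta> *\<^sub>R outer_product k d u) js"
      by (simp add: lookup_scaleR_tensor lookup_outer_product \<delta>'_def mult.assoc)
  qed
  ultimately show ?thesis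
    using that by auto
qed

text \<open>
  The bounds hold at all indices, also those that do not occur in the sum, so that the parameters
  range over a full product of compact intervals.
\<close>

definition bounded_decompositions :: "nat \<Rightarrow> (nat \<Rightarrow> nat) \<Rightarrow> nat \<Rightarrow> real \<Rightarrow> tensor set" where
  "bounded_decompositions k d r M =
     {\<Sum>p<r. \<delta> p *\<^sub>R outer_product k d (u p) | \<delta> u.
        (\<forall>p. \<delta> p \<in> {0..M}) \<and> (\<forall>p i j. u p i j \<in> {0..1})}"

text \<open>This is Tychonoff's theorem for the product topology on functions.\<close>

lemma compact_bounded_functions:
  fixes S :: "'b::topological_space set"
  assumes "compact S"
  shows "compact {f :: 'a \<Rightarrow> 'b. \<forall>x. f x \<in> S}"
proof -
  have "compactin (product_topology (\<lambda>_::'a. euclidean) UNIV) (PiE UNIV (\<lambda>_. S))"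
    using assms by (auto simp: compactin_PiE)
  moreover have "PiE UNIV (\<lambda>_::'a. S) = {f. \<forall>x. f x \<in> S}"
    by auto
  ultimately show ?thesis
    by (simp add: euclidean_product_topology)
qed

lemma compact_bounded_decompositions:
  "compact (bounded_decompositions k d r M)"
proof -
  define P :: "((nat \<Rightarrow> real) \<times> (nat \<Rightarrow> nat \<Rightarrow> nat \<Rightarrow> real)) set" where
    "P = {\<delta>. \<forall>p. \<delta> p \<in> {0..M}} \<times>
      {u. \<forall>p. u p \<in> {v. \<forall>i. v i \<in> {w. \<forall>j. w j \<in> {0..1}}}}"
  define g :: "(nat \<Rightarrow> real) \<times> (nat \<Rightarrow> nat \<Rightarrow> nat \<Rightarrow> real) \<Rightarrow> tensor" where
    "g = (\<lambda>(\<delta>, u). \<Sum>p<r. \<delta> p *\<^sub>R outer_product k d (u p))"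
  have "compact P"
    unfolding P_def by (intro compact_Times compact_bounded_functions compact_Icc)
  moreover have "continuous_on P g"
  proof -
    have \<delta>: "continuous_on P (\<lambda>x. fst x p)" for p
      by (rule continuous_on_product_then_coordinatewise[OF continuous_on_fst[OF continuous_on_id]])
    have u: "continuous_on P (\<lambda>x. snd x p i j)" for p i j
      by (rule continuous_on_product_then_coordinatewise[OF
            continuous_on_product_then_coordinatewise[OF
              continuous_on_product_then_coordinatewise[OF
                continuous_on_snd[OF continuous_on_id]]]])
    have single: "Poly_Mapping.single js c = c *\<^sub>R Poly_Mapping.single js (1::real)"
      for js :: "nat list" and c
      by (rule poly_mapping_eqI) (simp add: lookup_scaleR_tensor lookup_single when_def)
    have "g = (\<lambda>x. \<Sum>p<r. fst x p *\<^sub>R (\<Sum>js\<in>multi_indices k d.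
        (\<Prod>i<k. snd x p i (js ! i)) *\<^sub>R Poly_Mapping.single js 1))"
      unfolding g_def outer_product_def case_prod_unfold
      by (intro ext sum.cong refl arg_cong2[where f=scaleR] single)
    then show ?thesis
      by (auto intro!: continuous_intros \<delta> u)
  qed
  ultimately have "compact (g ` P)"
    by (rule compact_continuous_image[rotated])
  moreover have "g ` P = bounded_decompositions k d r M"
  proof (intro equalityI subsetI)
    fix X assume "X \<in> bounded_decompositions k d r M"
    then obtain \<delta> u where "X = g (\<delta>, u)" "(\<delta>, u) \<in> P"
      unfolding bounded_decompositions_def g_def P_def by fastforce
    then show "X \<in> g ` P"
      by blast
  next
    fix X assume "X \<in> g ` P"
    then obtain \<delta> u where "X = g (\<delta>, u)" "(\<delta>, u) \<in> P"
      by auto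
    then show "X \<in> bounded_decompositions k d r M"
      unfolding bounded_decompositions_def g_def P_def mem_Collect_eq
      by (intro exI[of _ \<delta>] exI[of _ u]) simp
  qed
  ultimately show ?thesis
    by simp
qed

lemma nonneg_rank_le_if_bounded_decomposition:
  assumes "X \<in> bounded_decompositions k d r M"
  shows "nonneg_rank k d X \<le> r"
proof -
  obtain \<delta> u where "\<And>p. \<delta> p \<in> {0..M}" and "\<And>p i j. u p i j \<in> {0..1}"
    and "X = (\<Sum>p<r. \<delta> p *\<^sub>R outer_product k d (u p))"
    using assms unfolding bounded_decompositions_def by blast
  then have "has_nonneg_decomposition k d X r"
    unfolding has_nonneg_decomposition_def by (intro exI[of _ \<delta>] exI[of _ u]) simp
  then show ?thesis
    unfolding nonneg_rank_def by (rule Least_le)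
qed

lemma bounded_decomposition_if_nonneg_rank_le:
  assumes X: "X \<in> nonneg_tensors k d" "nonneg_rank k d X \<le> r" "norm X \<le> M"
    and d: "\<And>i. i < k \<Longrightarrow> 0 < d i"
  shows "X \<in> bounded_decompositions k d r M"
proof -
  define s where "s = nonneg_rank k d X"
  have "has_nonneg_decomposition k d X s"
    unfolding s_def nonneg_rank_def
    using has_nonneg_decomposition_exists[OF X(1)] by (rule LeastI_ex)
  then obtain \<delta> u where \<delta>: "\<And>p. p < s \<Longrightarrow> 0 \<le> \<delta> p"
    and u: "\<And>p i j. p < s \<Longrightarrow> i < k \<Longrightarrow> j < d i \<Longrightarrow> 0 \<le> u p i j"
    and sum: "X = (\<Sum>p<s. \<delta> p *\<^sub>R outer_product k d (u p))"
    unfolding has_nonneg_decomposition_def by blast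
  have nonneg: "0 \<le> Poly_Mapping.lookup (\<delta> p *\<^sub>R outer_product k d (u p)) js"
    if "p < s" for p js
    using \<delta>[OF that] u[OF that]
    by (auto simp: lookup_scaleR_tensor lookup_outer_product multi_indices_def
        intro!: mult_nonneg_nonneg prod_nonneg)
  have "\<exists>\<delta>' u'. \<delta>' \<in> {0..M} \<and> (\<forall>i j. u' i j \<in> {0..1::real}) \<and>
      \<delta>' *\<^sub>R outer_product k d u' = \<delta> p *\<^sub>R outer_product k d (u p)" if p: "p < s" for p
  proof -
    have "Poly_Mapping.lookup (\<delta> p *\<^sub>R outer_product k d (u p)) js \<le> M" for js
    proof -
      have "Poly_Mapping.lookup (\<delta> p *\<^sub>R outer_product k d (u p)) js
          \<le> (\<Sum>p<s. Poly_Mapping.lookup (\<delta> p *\<^sub>R outer_product k d (u p)) js)"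
        using p nonneg
        by (intro member_le_sum[where f="\<lambda>p. Poly_Mapping.lookup (\<delta> p *\<^sub>R outer_product k d (u p)) js"])
          auto
      also have "\<dots> = Poly_Mapping.lookup X js"
        by (simp add: sum lookup_sum)
      also have "\<dots> \<le> M"
        using abs_lookup_le_norm[of X js] X(3) by linarith
      finally show ?thesis .
    qed
    then obtain \<delta>' u' where "\<delta>' \<in> {0..M}" "\<And>i j. u' i j \<in> {0..1::real}"
      "\<delta>' *\<^sub>R outer_product k d u' = \<delta> p *\<^sub>R outer_product k d (u p)"
      using normalized_outer_product[of "\<delta> p" k d "u p" M] \<delta>[OF p] u[OF p] d by blast
    then show ?thesis
      by blast
  qed
  then obtain \<delta>' u' where \<delta>': "\<And>p. p < s \<Longrightarrow> \<delta>' p \<in> {0..M}"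
    and u': "\<And>p i j. p < s \<Longrightarrow> u' p i j \<in> {0..1::real}"
    and eq: "\<And>p. p < s \<Longrightarrow> \<delta>' p *\<^sub>R outer_product k d (u' p) = \<delta> p *\<^sub>R outer_product k d (u p)"
    by metis
  \<comment> \<open>Zero terms fill the decomposition up to exactly \<open>r\<close> summands.\<close>
  define \<epsilon> where "\<epsilon> p = (if p < s then \<delta>' p else 0)" for p
  define v where "v p = (if p < s then u' p else (\<lambda>_ _. 0))" for p
  have "X = (\<Sum>p<s. \<epsilon> p *\<^sub>R outer_product k d (v p))"
    unfolding sum by (rule sum.cong) (simp_all add: \<epsilon>_def v_def eq)
  also have "\<dots> = (\<Sum>p<r. \<epsilon> p *\<^sub>R outer_product k d (v p))"
    using X(2) by (intro sum.mono_neutral_left) (auto simp: \<epsilon>_def s_def)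
  finally have "X = (\<Sum>p<r. \<epsilon> p *\<^sub>R outer_product k d (v p))" .
  moreover have "\<epsilon> p \<in> {0..M}" for p
    using \<delta>'[of p] order_trans[OF norm_ge_zero X(3)] by (simp add: \<epsilon>_def)
  moreover have "v p i j \<in> {0..1}" for p i j
    using u'[of p i j] by (simp add: v_def)
  ultimately show ?thesis
    unfolding bounded_decompositions_def by blast
qed

section \<open>Existence of a minimizer\<close>

theorem proposition7p2:
  fixes k r :: nat and d :: "nat \<Rightarrow> nat"
    and \<Omega> K :: "tensor set" and A :: tensor and \<phi> :: "tensor \<Rightarrow> real"
  assumes "0 < k" and "0 < r" and "\<And>i. i < k \<Longrightarrow> 0 < d i"
    and "closed \<Omega>" and "convex \<Omega>" and "\<Omega> \<subseteq> nonneg_tensors k d"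
    and "A \<in> \<Omega>"
    and "bregman_divergence \<Omega> \<phi>"
    and "closed K" and "K \<subseteq> rel_interior \<Omega>"
    and "{X \<in> K. nonneg_rank k d X \<le> r} \<noteq> {}"
  shows "\<exists>X \<in> {X \<in> K. nonneg_rank k d X \<le> r}.
           ereal (D_breg \<Omega> \<phi> A X) =
             (INF Y \<in> {X \<in> K. nonneg_rank k d X \<le> r}. ereal (D_breg \<Omega> \<phi> A Y))"
proof -
  define S where "S = {X \<in> K. nonneg_rank k d X \<le> r}"
  let ?D = "D_breg \<Omega> \<phi> A"
  obtain X0 where X0: "X0 \<in> S"
    using assms(11) unfolding S_def by blast
  have "bounded {X \<in> rel_interior \<Omega>. ?D X \<le> ?D X0}"
    using assms(7,8) by (simp add: bregman_divergence_def)
  then obtain M where M: "\<And>X. X \<in> rel_interior \<Omega> \<Longrightarrow> ?D X \<le> ?D X0 \<Longrightarrow> norm X \<le> M"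
    unfolding bounded_iff by blast
  define C where "C = K \<inter> bounded_decompositions k d r M"
  have C_S: "C \<subseteq> S"
    using nonneg_rank_le_if_bounded_decomposition by (auto simp: C_def S_def)
  have C: "X \<in> C" if "X \<in> S" "?D X \<le> ?D X0" for X
  proof -
    have "X \<in> rel_interior \<Omega>"
      using that(1) assms(10) by (auto simp: S_def)
    moreover from this have "X \<in> nonneg_tensors k d"
      using rel_interior_subset[of \<Omega>] assms(6) by blast
    ultimately show ?thesis
      using that M assms(3) bounded_decomposition_if_nonneg_rank_le
      by (simp add: C_def S_def)
  qed
  have "compact C"
    unfolding C_def using assms(9) compact_bounded_decompositions by (rule closed_Int_compact)
  moreover have "C \<noteq> {}"
    using C[OF X0] by auto
  moreover have "continuous_on C ?D"
  proof (rule continuous_on_subset)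
    show "continuous_on (rel_interior \<Omega>) ?D"
      using assms(7,8) by (intro continuous_on_D_breg) (simp_all add: bregman_divergence_def)
    show "C \<subseteq> rel_interior \<Omega>"
      using assms(10) by (auto simp: C_def)
  qed
  ultimately obtain X where X: "X \<in> C" and min: "\<And>Y. Y \<in> C \<Longrightarrow> ?D X \<le> ?D Y"
    using continuous_attains_inf[of C ?D] by blast
  \<comment> \<open>Candidates outside \<open>C\<close> have a larger divergence than \<open>X0\<close>, which itself lies in \<open>C\<close>.\<close>
  have "?D X \<le> ?D Y" if "Y \<in> S" for Y
    using min[of Y] min[OF C[OF X0]] C[OF that] by force
  then have "ereal (?D X) = (INF Y \<in> S. ereal (?D Y))"
    using X C_S by (intro antisym INF_greatest INF_lower) auto
  then show ?thesis
    using X C_S unfolding S_def by blast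
qed

end
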